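(* Let $(\mu,\vec\phi)$ be an eigenpair of the $1$-Laplacian of a connected graph $G$, and let $\vec\phi$ have a nodal domain decomposition into positive nodal domains $D^+_1,\dots,D^+_{r^+}$ and negative nodal domains $D^-_1,\dots,D^-_{r^-}$, so that $S(\vec\phi)=r^++r^-$. Then $$\mathrm{am}(\mu)\ge S(\vec\phi).$$
   Context: $G=(V,E)$ is a finite simple undirected connected graph, $V=\{1,\dots,n\}$, $n\ge 2$; $d_i$ is the degree of $i$; $\mathrm{vol}(A)=\sum_{i\in A}d_i$; $X=\{\vec x\in\mathbb R^n:\sum_i d_i|x_i|=1\}$. $\mathrm{Sgn}(t)=\{1\}$ if $t>0$, $\{-1\}$ if $t<0$, $[-1,1]$ if $t=0$. $(\mu,\vec x)$ with $\vec x\ne0$ is an eigenpair of the $1$-Laplacian if there exist $z_{ij}\in\mathrm{Sgn}(x_i-x_j)$ with $z_{ji}=-z_{ij}$ (for all adjacent $i,j$) such that $\sum_{j\sim i}z_{ij}\in\mu d_i\,\mathrm{Sgn}(x_i)$ for all $i\in V$. Eigenvectors are normalized to lie in $X$. For nonempty $D\subset V$, $\hat{\vec 1}_D$ is the indicator vector of $D$ divided by $\mathrm{vol}(D)$. A system $\{\vec\phi_1,\dots,\vec\phi_m\}$ of eigenvectors with eigenvalue $\mu$, where $\vec\phi_j=\hat{\vec 1}_{D_j}$ for $j=1,\dots,m$, is called a fundamental eigenvector system for $\mu$ if for every eigenpair $(\mu,\vec\psi)$ there exists $(a_1,\dots,a_m)\in\mathbb R^m$ such that $\vec\psi=\sum_{i=1}^m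 a_i\vec\phi_i$ and $\sum_{i=1}^m|a_i|=1$, and no $\vec\phi_j$ can be expressed linearly by the other eigenvectors in the system. The collection of all fundamental eigenvector systems for $\mu$ is partially ordered by inclusion, and its maximal elements are called maximal fundamental eigenvector systems. The algebraic multiplicity $\mathrm{am}(\mu)$ is the largest cardinality of a maximal fundamental eigenvector system for $\mu$. The positive (negative) nodal domains of $\vec x$ are the vertex sets of the connected components of the subgraph induced on $\{i:x_i>0\}$ ($\{i:x_i<0\}$); $S(\vec x)$ is the total number of positive and negative nodal domains.
   Formalization: Under linear independence, am(μ) can be undefined (K_4, μ=2/3: no fundamental system exists), so the bound is stated when a maximal system exists; it is also proved without this condition when "expressed linearly" means by combinations with coefficients of absolute sum 1. *)

theory Defs
  imports "HOL-Analysis.Analysis" "Graph_Theory.Graph_Theory"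
begin

text \<open>
  A finite simple undirected graph is a symmetric loop-free digraph without parallel arcs
  (\<^locale>\<open>graph\<close>), so each edge is a pair of opposite arcs and the degree of a vertex is
  its out-degree.  The vertex set is all of a finite index type, so that vectors over the
  vertices are elements of a Cartesian space.
\<close>

definition vol :: "('n::finite, 'b) pre_digraph \<Rightarrow> 'n set \<Rightarrow> real" where
  "vol G A = (\<Sum>i\<in>A. real (out_degree G i))"

definition X_sphere :: "('n::finite, 'b) pre_digraph \<Rightarrow> (real ^ 'n) set" where
  "X_sphere G = {x. (\<Sum>i\<in>UNIV. real (out_degree G i) * \<bar>x $ i\<bar>) = 1}"

definition Sgn :: "real \<Rightarrow> real set" where
  "Sgn t = (if t > 0 then {1} else if t < 0 then {-1} else {-1..1})"

definition eigenpair :: "('n::finite, 'b) pre_digraph \<Rightarrow> real \<Rightarrow> real ^ 'n \<Rightarrow> bool" where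
  "eigenpair G \<mu> x \<longleftrightarrow> x \<noteq> 0 \<and>
     (\<exists>z :: 'n \<Rightarrow> 'n \<Rightarrow> real.
        (\<forall>i j. i \<rightarrow>\<^bsub>G\<^esub> j \<longrightarrow> z i j \<in> Sgn (x $ i - x $ j) \<and> z j i = - z i j) \<and>
        (\<forall>i. (\<Sum>j | i \<rightarrow>\<^bsub>G\<^esub> j. z i j) \<in> (\<lambda>s. \<mu> * real (out_degree G i) * s) ` Sgn (x $ i)))"

definition ind_hat :: "('n::finite, 'b) pre_digraph \<Rightarrow> 'n set \<Rightarrow> real ^ 'n" where
  "ind_hat G D = (\<chi> i. indicator D i / vol G D)"

text \<open>In a symmetric digraph, strong components are the connected components.\<close>

definition positive_nodal_domains :: "('n::finite, 'b) pre_digraph \<Rightarrow> real ^ 'n \<Rightarrow> 'n set set" where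
  "positive_nodal_domains G x = verts ` pre_digraph.sccs (G \<restriction> {i. x $ i > 0})"

definition negative_nodal_domains :: "('n::finite, 'b) pre_digraph \<Rightarrow> real ^ 'n \<Rightarrow> 'n set set" where
  "negative_nodal_domains G x = verts ` pre_digraph.sccs (G \<restriction> {i. x $ i < 0})"

definition nodal_count :: "('n::finite, 'b) pre_digraph \<Rightarrow> real ^ 'n \<Rightarrow> nat" where
  "nodal_count G x = card (positive_nodal_domains G x) + card (negative_nodal_domains G x)"

definition unit_combinations :: "(real ^ 'n::finite) set \<Rightarrow> (real ^ 'n) set" where
  "unit_combinations F = {(\<Sum>f\<in>F. a f *\<^sub>R f) | a. (\<Sum>f\<in>F. \<bar>a f\<bar>) = 1}"

text \<open>
  The parameter \<open>expr\<close> is the sense in which no member of a system may be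
  expressed by the others: \<open>span\<close> gives linear independence, and
  \<open>unit_combinations\<close> admits only the combinations with coefficients of
  absolute sum 1 by which the system has to represent the eigenvectors.
  With \<open>span\<close> a system need not exist: for the complete graph on four vertices and
  \<open>\<mu> = 2/3\<close>, none of the six normalized indicators of two-element sets is
  a unit combination of other normalized indicator eigenvectors, so every system would
  contain all six, but they are linearly dependent.
\<close>

definition fundamental_system ::
  "((real ^ 'n) set \<Rightarrow> (real ^ 'n) set) \<Rightarrow> ('n::finite, 'b) pre_digraph \<Rightarrow> real \<Rightarrow>
    (real ^ 'n) set \<Rightarrow> bool" where
  "fundamental_system expr G \<mu> F \<longleftrightarrow>
     finite F \<and>
     (\<forall>f\<in>F. eigenpair G \<mu> f \<and> (\<exists>D. D \<noteq> {} \<and> f = ind_hat G D)) \<and>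
     (\<forall>\<psi>. eigenpair G \<mu> \<psi> \<and> \<psi> \<in> X_sphere G \<longrightarrow> \<psi> \<in> unit_combinations F) \<and>
     (\<forall>f\<in>F. f \<notin> expr (F - {f}))"

definition maximal_fundamental_systems ::
  "((real ^ 'n) set \<Rightarrow> (real ^ 'n) set) \<Rightarrow> ('n::finite, 'b) pre_digraph \<Rightarrow> real \<Rightarrow>
    (real ^ 'n) set set" where
  "maximal_fundamental_systems expr G \<mu> =
     {F. fundamental_system expr G \<mu> F \<and> (\<forall>F'. fundamental_system expr G \<mu> F' \<and> F \<subseteq> F' \<longrightarrow> F' = F)}"

text \<open>
  There are finitely many vectors \<^term>\<open>ind_hat G D\<close>, hence finitely many systems, so
  the maximum is meaningful as soon as a maximal system exists.
\<close>

definition am ::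
  "((real ^ 'n) set \<Rightarrow> (real ^ 'n) set) \<Rightarrow> ('n::finite, 'b) pre_digraph \<Rightarrow> real \<Rightarrow> nat" where
  "am expr G \<mu> = Max (card ` maximal_fundamental_systems expr G \<mu>)"

end

theory Submission
  imports Defs
begin

text \<open>
  The edge signs \<open>z\<close> and the degree condition that certify an eigenvector \<open>x\<close> also certify every
  \<open>y \<noteq> 0\<close> for which \<open>Sgn (x\<^sub>i - x\<^sub>j) \<subseteq> Sgn (y\<^sub>i - y\<^sub>j)\<close> on edges and
  \<open>Sgn x\<^sub>i \<subseteq> Sgn y\<^sub>i\<close> on vertices. This applies to the indicator of a nodal domain, and to
  the two parts obtained by cutting off the lowest positive layer of \<open>x\<close>. By the former, the span
  of a fundamental system contains the \<open>S(\<phi>)\<close> pairwise orthogonal indicators of the nodal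
  domains of \<open>\<phi>\<close>, so the system has at least \<open>S(\<phi>)\<close> members. By the latter, every eigenvector
  is a combination of indicator eigenvectors with the right absolute sum of coefficients, so a
  minimal set of indicator eigenvectors that still has this property is a system in the sense of
  \<^const>\<open>unit_combinations\<close>.
\<close>

subsection \<open>Transfer of eigenpairs\<close>

lemma eigenpair_transfer:
  assumes "eigenpair G \<mu> x" "y \<noteq> 0"
    and edges: "\<And>i j. i \<rightarrow>\<^bsub>G\<^esub> j \<Longrightarrow> Sgn (x $ i - x $ j) \<subseteq> Sgn (y $ i - y $ j)"
    and vertices: "\<And>i. Sgn (x $ i) \<subseteq> Sgn (y $ i)"
  shows "eigenpair G \<mu> y"
proof -
  obtain z where z: "\<And>i j. i \<rightarrow>\<^bsub>G\<^esub> j \<Longrightarrow> z i j \<in> Sgn (x $ i - x $ j) \<and> z j i = - z i j"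
    "\<And>i. (\<Sum>j | i \<rightarrow>\<^bsub>G\<^esub> j. z i j) \<in> (\<lambda>s. \<mu> * real (out_degree G i) * s) ` Sgn (x $ i)"
    using assms(1) unfolding eigenpair_def by blast
  show ?thesis
    unfolding eigenpair_def using assms(2) z edges vertices by (intro conjI exI[of _ z]) blast+
qed

lemma Sgn_uminus: "s \<in> Sgn (- t) \<longleftrightarrow> - s \<in> Sgn t"
  by (auto simp: Sgn_def)

lemma eigenpair_uminus:
  assumes "eigenpair G \<mu> x"
  shows "eigenpair G \<mu> (- x)"
proof -
  obtain z where z: "\<And>i j. i \<rightarrow>\<^bsub>G\<^esub> j \<Longrightarrow> z i j \<in> Sgn (x $ i - x $ j) \<and> z j i = - z i j"
    "\<And>i. (\<Sum>j | i \<rightarrow>\<^bsub>G\<^esub> j. z i j) \<in> (\<lambda>s. \<mu> * real (out_degree G i) * s) ` Sgn (x $ i)"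
    using assms unfolding eigenpair_def by blast
  have "- z i j \<in> Sgn ((- x) $ i - (- x) $ j) \<and> - z j i = - (- z i j)" if "i \<rightarrow>\<^bsub>G\<^esub> j" for i j
    using z(1)[OF that] Sgn_uminus[of "- z i j" "x $ i - x $ j"] by simp
  moreover have "(\<Sum>j | i \<rightarrow>\<^bsub>G\<^esub> j. - z i j)
      \<in> (\<lambda>s. \<mu> * real (out_degree G i) * s) ` Sgn ((- x) $ i)" for i
  proof -
    obtain s where "s \<in> Sgn (x $ i)" "(\<Sum>j | i \<rightarrow>\<^bsub>G\<^esub> j. z i j) = \<mu> * real (out_degree G i) * s"
      using z(2)[of i] by auto
    then show ?thesis
      by (intro image_eqI[of _ _ "- s"]) (auto simp: Sgn_uminus sum_negf)
  qed
  moreover have "- x \<noteq> 0"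
    using assms by (simp add: eigenpair_def)
  ultimately show ?thesis
    unfolding eigenpair_def by (intro conjI exI[of _ "\<lambda>i j. - z i j"]) blast+
qed

lemma vol_pos:
  assumes "\<And>i. out_degree G i > 0" "D \<noteq> {}"
  shows "vol G D > 0"
  unfolding vol_def using assms by (intro sum_pos) auto

lemma ind_hat_nth: "ind_hat G D $ i = (if i \<in> D then 1 / vol G D else 0)"
  by (simp add: ind_hat_def)

lemma ind_hat_nonzero:
  assumes "\<And>i. out_degree G i > 0" "D \<noteq> {}"
  shows "ind_hat G D \<noteq> 0"
proof -
  obtain i where "i \<in> D"
    using assms(2) by blast
  then have "ind_hat G D $ i \<noteq> 0"
    using vol_pos[of G D] assms by (simp add: ind_hat_nth)
  then show ?thesis
    by auto
qed

text \<open>Across an edge leaving \<open>D\<close> the vector \<open>x\<close> falls from a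
  positive to a nonpositive value, so the sign of the difference is kept. All other differences
  become 0, where \<open>Sgn\<close> is the whole interval. Besides single nodal domains, this
  covers the full set of positive vertices, used in the layer decomposition.\<close>

lemma eigenpair_ind_hat:
  assumes "eigenpair G \<mu> x" "D \<noteq> {}" "D \<subseteq> {i. x $ i > 0}"
    and deg: "\<And>i. out_degree G i > 0" and "symmetric G"
    and isolated: "\<And>i j. i \<in> D \<Longrightarrow> i \<rightarrow>\<^bsub>G\<^esub> j \<Longrightarrow> x $ j > 0 \<Longrightarrow> j \<in> D"
  shows "eigenpair G \<mu> (ind_hat G D)"
proof (rule eigenpair_transfer[OF assms(1)])
  note vol = vol_pos[OF deg assms(2)]
  show "ind_hat G D \<noteq> 0"
    using ind_hat_nonzero[OF deg assms(2)] .
  show "Sgn (x $ i) \<subseteq> Sgn (ind_hat G D $ i)" for i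
    using vol assms(3) by (auto simp: ind_hat_nth Sgn_def split: if_splits)
  fix i j assume ij: "i \<rightarrow>\<^bsub>G\<^esub> j"
  then have ji: "j \<rightarrow>\<^bsub>G\<^esub> i"
    using \<open>symmetric G\<close> by (auto simp: symmetric_def dest: symD)
  have "x $ j \<le> 0" if "i \<in> D" "j \<notin> D"
    using isolated[OF _ ij] that by force
  moreover have "x $ i \<le> 0" if "j \<in> D" "i \<notin> D"
    using isolated[OF _ ji] that by force
  ultimately show "Sgn (x $ i - x $ j) \<subseteq> Sgn (ind_hat G D $ i - ind_hat G D $ j)"
    using vol assms(3) by (force simp: ind_hat_nth Sgn_def split: if_splits)
qed

subsection \<open>Nodal domains\<close>

lemma positive_nodal_domains_eq:
  assumes "wf_digraph G"
  shows "positive_nodal_domains G x = pre_digraph.sccs_verts (G \<restriction> {i. x $ i > 0})"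
  using wf_digraph.sccs_verts_conv[OF wf_digraph.wellformed_induce_subgraph[OF assms]]
  by (simp add: positive_nodal_domains_def)

text \<open>With \<open>eigenpair_uminus\<close>, this reduces every fact about negative domains to
  the positive case.\<close>

lemma negative_nodal_domains_eq:
  "negative_nodal_domains G x = positive_nodal_domains G (- x)"
  by (simp add: negative_nodal_domains_def positive_nodal_domains_def)

lemma positive_nodal_domains_disjoint:
  assumes "wf_digraph G" "C \<in> positive_nodal_domains G x" "D \<in> positive_nodal_domains G x" "C \<noteq> D"
  shows "C \<inter> D = {}"
  using assms wf_digraph.sccs_verts_disjoint[OF wf_digraph.wellformed_induce_subgraph[OF assms(1)]]
  by (auto simp: positive_nodal_domains_eq)

lemma positive_nodal_domain_nonempty:
  assumes "wf_digraph G" "D \<in> positive_nodal_domains G x"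
  shows "D \<noteq> {}"
  using assms by (simp add: positive_nodal_domains_eq pre_digraph.sccs_verts_def)

lemma positive_nodal_domain_subset:
  assumes "D \<in> positive_nodal_domains G x"
  shows "D \<subseteq> {i. x $ i > 0}"
  using assms
  by (auto simp: positive_nodal_domains_def pre_digraph.sccs_def induced_subgraph_def subgraph_def)

text \<open>By symmetry, an edge between positive vertices gives arcs in both directions in the
  induced subgraph, so its ends are mutually reachable and share a strong component.\<close>

lemma positive_nodal_domain_isolated:
  assumes "wf_digraph G" "symmetric G" "D \<in> positive_nodal_domains G x"
    and "i \<in> D" "i \<rightarrow>\<^bsub>G\<^esub> j" "x $ j > 0"
  shows "j \<in> D"
proof -
  let ?H = "G \<restriction> {i. x $ i > 0}"
  interpret H: wf_digraph ?H
    using wf_digraph.wellformed_induce_subgraph[OF assms(1)] .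
  have "x $ i > 0"
    using positive_nodal_domain_subset[OF assms(3)] assms(4) by blast
  moreover have "j \<rightarrow>\<^bsub>G\<^esub> i"
    using assms(2,5) by (auto simp: symmetric_def dest: symD)
  ultimately have "i \<rightarrow>\<^bsub>?H\<^esub> j" "j \<rightarrow>\<^bsub>?H\<^esub> i"
    using assms(5,6) by (auto simp: arcs_ends_def arc_to_ends_def)
  then have "i \<rightarrow>\<^sup>*\<^bsub>?H\<^esub> j" "j \<rightarrow>\<^sup>*\<^bsub>?H\<^esub> i"
    by (auto intro: H.reachable_adjI)
  then show ?thesis
    using assms(3,4) by (auto simp: positive_nodal_domains_eq[OF assms(1)] pre_digraph.sccs_verts_def)
qed

lemma eigenpair_positive_nodal_domain:
  assumes "eigenpair G \<mu> x" "\<And>i. out_degree G i > 0" "wf_digraph G" "symmetric G"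
    and "D \<in> positive_nodal_domains G x"
  shows "eigenpair G \<mu> (ind_hat G D)"
  using assms(1) positive_nodal_domain_nonempty[OF assms(3,5)]
    positive_nodal_domain_subset[OF assms(5)] assms(2,4)
    positive_nodal_domain_isolated[OF assms(3-5)]
  by (rule eigenpair_ind_hat)

subsection \<open>Combinations of bounded absolute sum\<close>

text \<open>The inequality makes these sets stable under sums and scaling with an explicit radius;
  \<open>bounded_combinations_imp_unit\<close> later recovers equality.\<close>

definition bounded_combinations :: "(real ^ 'n::finite) set \<Rightarrow> real \<Rightarrow> (real ^ 'n) set" where
  "bounded_combinations F r = {(\<Sum>f\<in>F. a f *\<^sub>R f) | a. (\<Sum>f\<in>F. \<bar>a f\<bar>) \<le> r}"

lemma bounded_combinationsI:
  assumes "x = (\<Sum>f\<in>F. a f *\<^sub>R f)" "(\<Sum>f\<in>F. \<bar>a f\<bar>) \<le> r"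
  shows "x \<in> bounded_combinations F r"
  using assms unfolding bounded_combinations_def by blast

lemma bounded_combinationsE:
  assumes "x \<in> bounded_combinations F r"
  obtains a where "x = (\<Sum>f\<in>F. a f *\<^sub>R f)" "(\<Sum>f\<in>F. \<bar>a f\<bar>) \<le> r"
  using assms unfolding bounded_combinations_def by blast

lemma unit_combinations_imp_bounded:
  "x \<in> unit_combinations F \<Longrightarrow> x \<in> bounded_combinations F 1"
  by (auto simp: unit_combinations_def bounded_combinations_def)

lemma bounded_combinations_subset_span: "bounded_combinations F r \<subseteq> span F"
  by (auto simp: bounded_combinations_def intro: span_sum span_scale span_base)

lemma zero_in_bounded_combinations: "r \<ge> 0 \<Longrightarrow> 0 \<in> bounded_combinations F r"
  by (rule bounded_combinationsI[where a = "\<lambda>_. 0"]) auto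

lemma member_in_bounded_combinations:
  assumes "finite F" "f \<in> F"
  shows "f \<in> bounded_combinations F 1"
proof (rule bounded_combinationsI)
  show "f = (\<Sum>g\<in>F. (if g = f then 1 else 0) *\<^sub>R g)"
    using assms by (simp add: if_distrib[of "\<lambda>c. c *\<^sub>R _"] sum.delta cong: if_cong)
  show "(\<Sum>g\<in>F. \<bar>if g = f then 1 else 0 :: real\<bar>) \<le> 1"
    using assms by (simp add: if_distrib[of abs] sum.delta cong: if_cong)
qed

lemma bounded_combinations_add:
  assumes "x \<in> bounded_combinations F r" "y \<in> bounded_combinations F s"
  shows "x + y \<in> bounded_combinations F (r + s)"
proof -
  obtain a where a: "x = (\<Sum>f\<in>F. a f *\<^sub>R f)" "(\<Sum>f\<in>F. \<bar>a f\<bar>) \<le> r"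
    using assms(1) by (rule bounded_combinationsE)
  obtain b where b: "y = (\<Sum>f\<in>F. b f *\<^sub>R f)" "(\<Sum>f\<in>F. \<bar>b f\<bar>) \<le> s"
    using assms(2) by (rule bounded_combinationsE)
  have "(\<Sum>f\<in>F. \<bar>a f + b f\<bar>) \<le> (\<Sum>f\<in>F. \<bar>a f\<bar> + \<bar>b f\<bar>)"
    by (intro sum_mono) auto
  then show ?thesis
    using a b
    by (intro bounded_combinationsI[where a = "\<lambda>f. a f + b f"])
      (auto simp: sum.distrib scaleR_add_left)
qed

lemma bounded_combinations_scaleR:
  assumes "x \<in> bounded_combinations F r"
  shows "c *\<^sub>R x \<in> bounded_combinations F (\<bar>c\<bar> * r)"
proof -
  obtain a where a: "x = (\<Sum>f\<in>F. a f *\<^sub>R f)" "(\<Sum>f\<in>F. \<bar>a f\<bar>) \<le> r"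
    using assms by (rule bounded_combinationsE)
  have "(\<Sum>f\<in>F. \<bar>c * a f\<bar>) = \<bar>c\<bar> * (\<Sum>f\<in>F. \<bar>a f\<bar>)"
    by (simp add: abs_mult sum_distrib_left)
  then show ?thesis
    using a
    by (intro bounded_combinationsI[where a = "\<lambda>f. c * a f"])
      (auto simp: scaleR_sum_right intro: mult_left_mono)
qed

lemma bounded_combinations_mono:
  assumes "x \<in> bounded_combinations F r" "r \<le> s"
  shows "x \<in> bounded_combinations F s"
  using assms by (fastforce simp: bounded_combinations_def)

lemma bounded_combinations_trans:
  assumes "x \<in> bounded_combinations F r"
    and F: "\<And>f. f \<in> F \<Longrightarrow> f \<in> bounded_combinations F' 1"
  shows "x \<in> bounded_combinations F' r"
proof -
  obtain a where a: "x = (\<Sum>f\<in>F. a f *\<^sub>R f)" "(\<Sum>f\<in>F. \<bar>a f\<bar>) \<le> r"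
    using assms(1) by (rule bounded_combinationsE)
  \<comment> \<open>Partial sums carry their exact radius through the induction; the bound
    \<open>r\<close> enters only at the end.\<close>
  have "(\<Sum>f\<in>S. a f *\<^sub>R f) \<in> bounded_combinations F' (\<Sum>f\<in>S. \<bar>a f\<bar>)" if "S \<subseteq> F" for S
    using that
  proof (induction S rule: infinite_finite_induct)
    case (insert f S)
    have "a f *\<^sub>R f \<in> bounded_combinations F' \<bar>a f\<bar>"
      using bounded_combinations_scaleR[OF F, of f "a f"] insert.prems by simp
    with insert show ?case
      by (auto intro: bounded_combinations_add)
  qed (auto intro: zero_in_bounded_combinations)
  from this[of F] show ?thesis
    using a by (auto intro: bounded_combinations_mono)
qed

subsection \<open>The layer decomposition\<close>

text \<open>\<open>X_sphere G\<close> is the set where this value is 1.\<close>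

definition weighted_norm :: "('n::finite, 'b) pre_digraph \<Rightarrow> real ^ 'n \<Rightarrow> real" where
  "weighted_norm G x = (\<Sum>i\<in>UNIV. real (out_degree G i) * \<bar>x $ i\<bar>)"

lemma weighted_norm_uminus: "weighted_norm G (- x) = weighted_norm G x"
  by (simp add: weighted_norm_def)

lemma weighted_norm_zero: "weighted_norm G 0 = 0"
  by (simp add: weighted_norm_def)

lemma weighted_norm_scaleR: "weighted_norm G (c *\<^sub>R x) = \<bar>c\<bar> * weighted_norm G x"
  by (simp add: weighted_norm_def sum_distrib_left abs_mult mult_ac)

lemma weighted_norm_add_le: "weighted_norm G (x + y) \<le> weighted_norm G x + weighted_norm G y"
  unfolding weighted_norm_def sum.distrib[symmetric]
  by (intro sum_mono) (simp add: distrib_left[symmetric] mult_left_mono)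

lemma weighted_norm_sum_le: "weighted_norm G (\<Sum>f\<in>F. g f) \<le> (\<Sum>f\<in>F. weighted_norm G (g f))"
proof (induction F rule: infinite_finite_induct)
  case (insert f F)
  then show ?case
    using weighted_norm_add_le[of G "g f" "sum g F"] by simp
qed (auto simp: weighted_norm_zero)

lemma weighted_norm_ind_hat:
  assumes "\<And>i. out_degree G i > 0" "D \<noteq> {}"
  shows "weighted_norm G (ind_hat G D) = 1"
proof -
  have "weighted_norm G (ind_hat G D)
      = (\<Sum>i\<in>UNIV. if i \<in> D then real (out_degree G i) / vol G D else 0)"
    unfolding weighted_norm_def using vol_pos[OF assms]
    by (intro sum.cong) (auto simp: ind_hat_nth)
  also have "\<dots> = (\<Sum>i\<in>D. real (out_degree G i) / vol G D)"
    by (simp add: sum.If_cases)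
  also have "\<dots> = 1"
    using vol_pos[OF assms] by (simp add: sum_divide_distrib[symmetric] vol_def)
  finally show ?thesis .
qed

text \<open>
  Every combination of unit vectors that has norm 1 uses coefficients of absolute sum at least 1,
  so that for these vectors the bound 1 is attained.
\<close>

lemma bounded_combinations_imp_unit:
  assumes "x \<in> bounded_combinations F 1" "weighted_norm G x = 1"
    and "\<And>f. f \<in> F \<Longrightarrow> weighted_norm G f = 1"
  shows "x \<in> unit_combinations F"
proof -
  obtain a where a: "x = (\<Sum>f\<in>F. a f *\<^sub>R f)" "(\<Sum>f\<in>F. \<bar>a f\<bar>) \<le> 1"
    using assms(1) by (rule bounded_combinationsE)
  have "1 \<le> (\<Sum>f\<in>F. weighted_norm G (a f *\<^sub>R f))"
    using weighted_norm_sum_le[of G "\<lambda>f. a f *\<^sub>R f" F] a(1) assms(2) by simp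
  also have "\<dots> = (\<Sum>f\<in>F. \<bar>a f\<bar>)"
    using assms(3) by (intro sum.cong) (auto simp: weighted_norm_scaleR)
  finally show ?thesis
    using a unfolding unit_combinations_def by force
qed

text \<open>The finite pool from which every fundamental system is drawn; its finiteness provides
  minimal generating sets and maximal systems.\<close>

definition indicator_eigenvectors ::
  "('n::finite, 'b) pre_digraph \<Rightarrow> real \<Rightarrow> (real ^ 'n) set" where
  "indicator_eigenvectors G \<mu> = {f. eigenpair G \<mu> f \<and> (\<exists>D. D \<noteq> {} \<and> f = ind_hat G D)}"

lemma finite_indicator_eigenvectors: "finite (indicator_eigenvectors G \<mu>)"
  by (rule finite_subset[of _ "range (ind_hat G)"]) (auto simp: indicator_eigenvectors_def)

lemma weighted_norm_indicator_eigenvector: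
  assumes "\<And>i. out_degree G i > 0" "f \<in> indicator_eigenvectors G \<mu>"
  shows "weighted_norm G f = 1"
  using assms weighted_norm_ind_hat by (auto simp: indicator_eigenvectors_def)

text \<open>Induction on the size of the support. Removing the lowest positive layer shrinks the
  support, and the norms of the two parts add without loss, so the radius is exactly the norm. If no
  chosen entry is positive, \<open>- x\<close> is treated instead.\<close>

lemma eigenpair_in_bounded_combinations:
  assumes deg: "\<And>i. out_degree G i > 0" and "symmetric G" and "eigenpair G \<mu> x"
  shows "x \<in> bounded_combinations (indicator_eigenvectors G \<mu>) (weighted_norm G x)"
  using assms(3)
proof (induction "card {i. x $ i \<noteq> 0}" arbitrary: x rule: less_induct)
  case less
  let ?E = "indicator_eigenvectors G \<mu>"
  \<comment> \<open>The induction hypothesis is a premise about an arbitrary \<open>x\<close>, so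
    that the claim serves both the given vector and its negative, whose support has the same
    size.\<close>
  have positive: "x \<in> bounded_combinations ?E (weighted_norm G x)"
    if x: "eigenpair G \<mu> x" and "x $ k > 0"
      and IH: "\<And>y. card {i. y $ i \<noteq> 0} < card {i. x $ i \<noteq> 0} \<Longrightarrow> eigenpair G \<mu> y \<Longrightarrow>
        y \<in> bounded_combinations ?E (weighted_norm G y)" for x k
  proof -
    define A where "A = {i. x $ i > 0}"
    define m where "m = Min (($) x ` A)"
    define y where "y = (\<chi> i. if x $ i > 0 then x $ i - m else x $ i)"
    have A: "A \<noteq> {}"
      using \<open>x $ k > 0\<close> by (auto simp: A_def)
    have m_le: "m \<le> x $ i" if "x $ i > 0" for i
      unfolding m_def by (rule Min_le) (use that in \<open>auto simp: A_def\<close>)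
    have "m \<in> ($) x ` A"
      unfolding m_def using A by (intro Min_in) auto
    then obtain l where l: "x $ l = m" "m > 0"
      by (auto simp: A_def)
    have "eigenpair G \<mu> (ind_hat G A)"
      using x A _ deg \<open>symmetric G\<close> by (rule eigenpair_ind_hat) (auto simp: A_def)
    then have ind_hat_A: "ind_hat G A \<in> ?E"
      using A by (auto simp: indicator_eigenvectors_def)
    \<comment> \<open>The factor \<open>vol G A\<close> undoes the normalization of
      \<open>ind_hat G A\<close>.\<close>
    have split: "x = y + (m * vol G A) *\<^sub>R ind_hat G A"
      using vol_pos[OF deg A] by (auto simp: vec_eq_iff y_def ind_hat_nth A_def)
    \<comment> \<open>On \<open>A\<close> the entries of \<open>y\<close> stay nonnegative by
      \<open>m_le\<close>, so absolute values drop by exactly \<open>m\<close>.\<close>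
    have "weighted_norm G x = weighted_norm G y + (\<Sum>i\<in>UNIV. if i \<in> A then m * real (out_degree G i) else 0)"
      unfolding weighted_norm_def sum.distrib[symmetric]
      by (intro sum.cong) (auto simp: y_def A_def algebra_simps dest: m_le)
    also have "(\<Sum>i\<in>UNIV. if i \<in> A then m * real (out_degree G i) else 0) = m * vol G A"
      by (simp add: sum.If_cases vol_def sum_distrib_left)
    finally have norm: "weighted_norm G x = weighted_norm G y + m * vol G A" .
    have "y \<in> bounded_combinations ?E (weighted_norm G y)"
    proof (cases "y = 0")
      case True
      then show ?thesis
        by (simp add: weighted_norm_zero zero_in_bounded_combinations)
    next
      case False
      have "eigenpair G \<mu> y"
        using x False
      proof (rule eigenpair_transfer)
        \<comment> \<open>Only differences between a positive and a nonpositive entry change, by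
          \<open>m\<close>; they keep their sign or become 0.\<close>
        show "Sgn (x $ i - x $ j) \<subseteq> Sgn (y $ i - y $ j)" for i j
          using m_le[of i] m_le[of j] by (auto simp: y_def Sgn_def)
        show "Sgn (x $ i) \<subseteq> Sgn (y $ i)" for i
          using m_le[of i] by (auto simp: y_def Sgn_def)
      qed
      moreover have "{i. y $ i \<noteq> 0} \<subset> {i. x $ i \<noteq> 0}"
      proof (rule psubsetI)
        show "{i. y $ i \<noteq> 0} \<subseteq> {i. x $ i \<noteq> 0}"
          by (auto simp: y_def)
        \<comment> \<open>The vertex \<open>l\<close> attaining the minimum leaves the
          support.\<close>
        have "x $ l \<noteq> 0" "y $ l = 0"
          using l by (simp_all add: y_def)
        then show "{i. y $ i \<noteq> 0} \<noteq> {i. x $ i \<noteq> 0}"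
          by blast
      qed
      ultimately show ?thesis
        by (intro IH psubset_card_mono) auto
    qed
    moreover have "(m * vol G A) *\<^sub>R ind_hat G A \<in> bounded_combinations ?E (m * vol G A)"
      using bounded_combinations_scaleR[OF member_in_bounded_combinations[OF
          finite_indicator_eigenvectors ind_hat_A], of "m * vol G A"] l vol_pos[OF deg A]
      by simp
    ultimately have "y + (m * vol G A) *\<^sub>R ind_hat G A
        \<in> bounded_combinations ?E (weighted_norm G y + m * vol G A)"
      by (rule bounded_combinations_add)
    with split norm show ?thesis
      by simp
  qed
  obtain k where "x $ k \<noteq> 0"
    using less.prems by (auto simp: eigenpair_def vec_eq_iff)
  then consider "x $ k > 0" | "(- x) $ k > 0"
    by fastforce
  then show ?case
  proof cases
    case 1
    then show ?thesis
      using positive[OF less.prems] less.hyps by blast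
  next
    case 2
    have "- x \<in> bounded_combinations ?E (weighted_norm G (- x))"
      using less.hyps by (intro positive[OF eigenpair_uminus[OF less.prems] 2]) auto
    then show ?thesis
      using bounded_combinations_scaleR[of "- x" ?E _ "- 1"] by (simp add: weighted_norm_uminus)
  qed
qed

subsection \<open>Fundamental systems\<close>

lemma fundamental_system_subset:
  "fundamental_system expr G \<mu> F \<Longrightarrow> F \<subseteq> indicator_eigenvectors G \<mu>"
  by (auto simp: fundamental_system_def indicator_eigenvectors_def)

lemma finite_fundamental_systems: "finite {F. fundamental_system expr G \<mu> F}"
  by (rule finite_subset[of _ "Pow (indicator_eigenvectors G \<mu>)"])
    (auto dest: fundamental_system_subset simp: finite_indicator_eigenvectors)

text \<open>A minimal subset of the pool that still generates the pool with radius 1 is a system: if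
  a member were a unit combination of the others, deleting it would leave a smaller generating
  set.\<close>

lemma fundamental_system_unit_combinations_exists:
  assumes deg: "\<And>i. out_degree G i > 0" and "symmetric G"
  shows "\<exists>F. fundamental_system unit_combinations G \<mu> F"
proof -
  let ?E = "indicator_eigenvectors G \<mu>"
  let ?generates = "\<lambda>F. \<forall>e\<in>?E. e \<in> bounded_combinations F 1"
  have "finite {F. F \<subseteq> ?E \<and> ?generates F}"
    by (rule finite_subset[of _ "Pow ?E"]) (auto simp: finite_indicator_eigenvectors)
  moreover have "?E \<in> {F. F \<subseteq> ?E \<and> ?generates F}"
    by (auto intro: member_in_bounded_combinations finite_indicator_eigenvectors)
  ultimately obtain F where "F \<in> {F. F \<subseteq> ?E \<and> ?generates F}"
    and "\<forall>F' \<in> {F. F \<subseteq> ?E \<and> ?generates F}. F' \<subseteq> F \<longrightarrow> F = F'"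
    by (metis (no_types, lifting) finite_has_minimal empty_iff)
  then have F: "F \<subseteq> ?E" "?generates F"
    and minimal: "\<And>F'. F' \<subseteq> ?E \<Longrightarrow> ?generates F' \<Longrightarrow> F' \<subseteq> F \<Longrightarrow> F' = F"
    by auto
  have "finite F"
    using F(1) finite_indicator_eigenvectors finite_subset by blast
  have norm: "weighted_norm G f = 1" if "f \<in> F" for f
    using weighted_norm_indicator_eigenvector[OF deg] F(1) that by blast
  have "\<psi> \<in> unit_combinations F" if "eigenpair G \<mu> \<psi>" "\<psi> \<in> X_sphere G" for \<psi>
  proof -
    have "weighted_norm G \<psi> = 1"
      using that(2) by (simp add: X_sphere_def weighted_norm_def)
    \<comment> \<open>The layer decomposition expresses \<psi> by the whole pool; transitivity then
      replaces the pool by \<open>F\<close> at the same radius.\<close>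
    moreover from this have "\<psi> \<in> bounded_combinations ?E 1"
      using eigenpair_in_bounded_combinations[OF deg \<open>symmetric G\<close> that(1)] by simp
    then have "\<psi> \<in> bounded_combinations F 1"
      using F(2) by (blast intro: bounded_combinations_trans)
    ultimately show ?thesis
      using norm by (blast intro: bounded_combinations_imp_unit)
  qed
  moreover have "f \<notin> unit_combinations (F - {f})" if f: "f \<in> F" for f
  proof
    assume "f \<in> unit_combinations (F - {f})"
    then have "g \<in> bounded_combinations (F - {f}) 1" if "g \<in> F" for g
      using that \<open>finite F\<close>
      by (cases "g = f") (auto intro: unit_combinations_imp_bounded member_in_bounded_combinations)
    then have "?generates (F - {f})"
      using F(2) by (blast intro: bounded_combinations_trans)
    then show False
      using minimal[of "F - {f}"] F(1) f by blast
  qed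
  ultimately have "fundamental_system unit_combinations G \<mu> F"
    using F(1) \<open>finite F\<close> unfolding fundamental_system_def indicator_eigenvectors_def by blast
  then show ?thesis ..
qed

lemma maximal_fundamental_systems_nonempty:
  assumes "fundamental_system expr G \<mu> F"
  shows "maximal_fundamental_systems expr G \<mu> \<noteq> {}"
proof -
  obtain M where "fundamental_system expr G \<mu> M"
    "\<And>F'. fundamental_system expr G \<mu> F' \<Longrightarrow> M \<subseteq> F' \<Longrightarrow> F' = M"
    using finite_has_maximal[OF finite_fundamental_systems[of expr G \<mu>]] assms by auto
  then have "M \<in> maximal_fundamental_systems expr G \<mu>"
    unfolding maximal_fundamental_systems_def by blast
  then show ?thesis
    by blast
qed

text \<open>Indicators of disjoint nonempty sets are nonzero and pairwise orthogonal, hence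
  independent.\<close>

lemma card_disjoint_family_le_card_spanning:
  fixes F :: "(real ^ 'n::finite) set"
  assumes deg: "\<And>i. out_degree G i > 0" and "finite F"
    and nonempty: "{} \<notin> \<D>"
    and disjoint: "\<And>C D. C \<in> \<D> \<Longrightarrow> D \<in> \<D> \<Longrightarrow> C \<noteq> D \<Longrightarrow> C \<inter> D = {}"
    and in_span: "ind_hat G ` \<D> \<subseteq> span F"
  shows "card \<D> \<le> card F"
proof -
  have nonzero: "ind_hat G D \<noteq> 0" if "D \<in> \<D>" for D
    using ind_hat_nonzero[OF deg] nonempty that by metis
  have orth: "orthogonal (ind_hat G C) (ind_hat G D)" if "C \<in> \<D>" "D \<in> \<D>" "C \<noteq> D" for C D
    using disjoint[OF that] by (auto simp: orthogonal_def inner_vec_def ind_hat_nth intro!: sum.neutral)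
  \<comment> \<open>Two distinct members with equal indicators would yield a vector orthogonal to
    itself, hence zero.\<close>
  have "inj_on (ind_hat G) \<D>"
    using orth nonzero by (metis inj_onI orthogonal_self)
  moreover have "independent (ind_hat G ` \<D>)"
    using orth nonzero
    by (intro pairwise_orthogonal_independent) (fastforce simp: pairwise_def)+
  ultimately have "card \<D> \<le> dim (span F)"
    using independent_card_le_dim[OF in_span] by (simp add: card_image)
  also have "\<dots> \<le> card F"
    using \<open>finite F\<close> by (simp add: dim_le_card')
  finally show ?thesis .
qed

text \<open>The normalized indicators of the nodal domains are eigenvectors in
  \<open>X_sphere G\<close>, so the system represents them and they lie in its span. Keeping
  \<open>expr\<close> arbitrary treats both senses of a system at once.\<close>

lemma nodal_count_le_card_fundamental_system:
  assumes deg: "\<And>i. out_degree G i > 0" and wf: "wf_digraph G" and sym: "symmetric G"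
    and \<phi>: "eigenpair G \<mu> \<phi>" and F: "fundamental_system expr G \<mu> F"
  shows "nodal_count G \<phi> \<le> card F"
proof -
  let ?P = "positive_nodal_domains G \<phi>" and ?N = "positive_nodal_domains G (- \<phi>)"
  have pos_neg: "C \<inter> D = {}" if "C \<in> ?P" "D \<in> ?N" for C D
    using that[THEN positive_nodal_domain_subset] by force
  have nonempty: "{} \<notin> ?P \<union> ?N"
    using positive_nodal_domain_nonempty[OF wf] by blast
  have "ind_hat G D \<in> span F" if D: "D \<in> ?P \<union> ?N" for D
  proof -
    have "eigenpair G \<mu> (ind_hat G D)"
      using D eigenpair_positive_nodal_domain[OF \<phi> deg wf sym]
        eigenpair_positive_nodal_domain[OF eigenpair_uminus[OF \<phi>] deg wf sym] by blast
    moreover have "ind_hat G D \<in> X_sphere G"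
      using weighted_norm_ind_hat[OF deg, of D] D nonempty
      by (auto simp: X_sphere_def weighted_norm_def)
    ultimately show ?thesis
      using F unit_combinations_imp_bounded bounded_combinations_subset_span
      unfolding fundamental_system_def by blast
  qed
  then have "card (?P \<union> ?N) \<le> card F"
    using deg F nonempty pos_neg positive_nodal_domains_disjoint[OF wf]
    by (intro card_disjoint_family_le_card_spanning[of G])
      (auto simp: fundamental_system_def, (blast+)?)
  \<comment> \<open>A set in both families would be disjoint from itself, hence empty.\<close>
  moreover have "?P \<inter> ?N = {}"
    using nonempty pos_neg by (metis UnI1 disjoint_iff inf.idem)
  ultimately show ?thesis
    by (simp add: nodal_count_def negative_nodal_domains_eq card_Un_disjoint)
qed

lemma nodal_count_le_am:
  assumes "\<And>i. out_degree G i > 0" "wf_digraph G" "symmetric G" "eigenpair G \<mu> \<phi>"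
    and "maximal_fundamental_systems expr G \<mu> \<noteq> {}"
  shows "nodal_count G \<phi> \<le> am expr G \<mu>"
proof -
  obtain F where F: "F \<in> maximal_fundamental_systems expr G \<mu>"
    using assms(5) by blast
  have "finite (maximal_fundamental_systems expr G \<mu>)"
    by (rule finite_subset[OF _ finite_fundamental_systems[of expr G \<mu>]])
      (auto simp: maximal_fundamental_systems_def)
  then have "card F \<le> am expr G \<mu>"
    unfolding am_def using F by (intro Max_ge) auto
  moreover have "nodal_count G \<phi> \<le> card F"
    using F by (intro nodal_count_le_card_fundamental_system[OF assms(1-4)])
      (auto simp: maximal_fundamental_systems_def)
  ultimately show ?thesis
    by linarith
qed

text \<open>A path from \<open>u\<close> to another vertex starts with an edge at \<open>u\<close>.
  It lives in the symmetric closure, which adds nothing to the symmetric arcs.\<close>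

lemma (in graph) out_degree_pos:
  assumes "connected G" "u \<in> verts G" "v \<in> verts G" "u \<noteq> v"
  shows "out_degree G u > 0"
proof -
  have "(u, v) \<in> rtrancl_on (verts G) ((arcs_ends G)\<^sup>s)"
    using assms by (auto simp: connected_conv)
  then obtain w where "(u, w) \<in> (arcs_ends G)\<^sup>s"
    using assms(4) by (cases rule: converse_rtrancl_on_cases) auto
  then have "u \<rightarrow>\<^bsub>G\<^esub> w"
    using sym_arcs by (auto simp: symcl_def symmetric_def dest: symD)
  then have "out_arcs G u \<noteq> {}"
    by (auto simp: out_arcs_def arcs_ends_def arc_to_ends_def)
  then show ?thesis
    by (simp add: out_degree_def card_gt_0_iff finite_out_arcs)
qed

theorem theorem10:
  fixes G :: "('n::finite, 'b) pre_digraph" and \<mu> :: real and \<phi> :: "real ^ 'n"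
  assumes "graph G" and "verts G = UNIV" and "CARD('n) \<ge> 2"
    and "Digraph_Component.connected G"
    and "eigenpair G \<mu> \<phi>"
  shows "(maximal_fundamental_systems span G \<mu> \<noteq> {} \<longrightarrow> am span G \<mu> \<ge> nodal_count G \<phi>) \<and>
         (maximal_fundamental_systems unit_combinations G \<mu> \<noteq> {} \<and>
          am unit_combinations G \<mu> \<ge> nodal_count G \<phi>)"
proof -
  interpret graph G
    by fact
  have deg: "out_degree G i > 0" for i
  proof -
    have "UNIV \<noteq> {i}"
    proof
      assume "UNIV = {i}"
      then have "CARD('n) = card {i}"
        by (rule arg_cong)
      then show False
        using assms(3) by simp
    qed
    then obtain j where "i \<noteq> j"
      by (metis UNIV_eq_I singleton_iff)
    then show ?thesis
      using out_degree_pos assms(2,4) by auto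
  qed
  have nonempty: "maximal_fundamental_systems unit_combinations G \<mu> \<noteq> {}"
    using fundamental_system_unit_combinations_exists[OF deg sym_arcs]
      maximal_fundamental_systems_nonempty by blast
  show ?thesis
    using nodal_count_le_am[OF deg wf_digraph_axioms sym_arcs assms(5)] nonempty by blast
qed

end
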